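(* Let $\mu$ be a finite measure on a measurable space $(\Omega,\Sigma)$, let $K$ be a compact Hausdorff space, and let $L_1(\mu)$ and $C(K)$ be the real Banach spaces. Let $0<\varepsilon<1$. Suppose that $T\in\mathcal{L}(L_1(\mu),C(K))$ has norm one and that the map $s\mapsto T^*\delta_s$ from $K$ to $L_\infty(\mu)$ is continuous in measure. If $\|Tf\|>1-\frac{\varepsilon^2}{6}$ for some $f\in L_1(\mu)$ with $\|f\|=1$, then there exist $S\in\mathcal{L}(L_1(\mu),C(K))$ with $\|S\|=1$ and $g\in L_1(\mu)$ with $\|g\|=1$ such that $\|Sg\|=1$, $\|S-T\|<\varepsilon$ and $\|f-g\|<\varepsilon$. Moreover, $S$ can be taken such that the map $s\mapsto S^*\delta_s$ from $K$ to $L_\infty(\mu)$ is also continuous in measure.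
   Context: $\mathcal{L}(X,Y)$ is the space of bounded linear operators from $X$ to $Y$ with the operator norm. For $s\in K$, $\delta_s\in C(K)^*$ is the point measure (evaluation) at $s$, and $T^*\delta_s\in L_1(\mu)^*=L_\infty(\mu)$, so that $Tf(s)=\int_\Omega f\cdot T^*\delta_s\,d\mu$. "Continuous in measure" means continuous when $L_\infty(\mu)$ carries the topology of convergence in $\mu$-measure. *)

theory Defs
  imports "HOL-Analysis.Analysis"
begin

text \<open>
  The elements of \<open>L\<^sub>1(M)\<close> and \<open>L\<^sub>\<infinity>(M)\<close> are handled through their representatives: an element of
  \<open>L\<^sub>1(M)\<close> is given by a real function \<open>f\<close> with \<open>integrable M f\<close>, two such functions being
  the same element iff they agree almost everywhere.  For compact \<open>K\<close> (the whole of a type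
  \<open>'k\<close>), the Banach space \<open>C(K)\<close> is the library type \<open>'k \<Rightarrow>\<^sub>C real\<close> with the supremum norm.
\<close>

definition L1_norm :: "'a measure \<Rightarrow> ('a \<Rightarrow> real) \<Rightarrow> real"
  where "L1_norm M f = (\<integral>x. \<bar>f x\<bar> \<partial>M)"

definition Linfty :: "'a measure \<Rightarrow> ('a \<Rightarrow> real) set"
  where "Linfty M = {h \<in> borel_measurable M. \<exists>C. AE x in M. \<bar>h x\<bar> \<le> C}"

text \<open>
  The bounded linear operators from \<open>L\<^sub>1(M)\<close> to a normed space.  Linearity and the bound
  give \<open>norm (T f - T g) \<le> C * L1_norm M (f - g)\<close>, so such a \<open>T\<close> takes equal values on
  functions that agree almost everywhere and is an operator on the classes.  Its values
  outside of the integrable functions are irrelevant.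
\<close>

definition L1_operators :: "'a measure \<Rightarrow> (('a \<Rightarrow> real) \<Rightarrow> 'b::real_normed_vector) set"
  where "L1_operators M = {T.
    (\<forall>f g. integrable M f \<longrightarrow> integrable M g \<longrightarrow> T (\<lambda>x. f x + g x) = T f + T g) \<and>
    (\<forall>c f. integrable M f \<longrightarrow> T (\<lambda>x. c * f x) = c *\<^sub>R T f) \<and>
    (\<exists>C. \<forall>f. integrable M f \<longrightarrow> norm (T f) \<le> C * L1_norm M f)}"

definition L1_op_norm :: "'a measure \<Rightarrow> (('a \<Rightarrow> real) \<Rightarrow> 'b::real_normed_vector) \<Rightarrow> real"
  where "L1_op_norm M T = Sup {norm (T f) |f. integrable M f \<and> L1_norm M f \<le> 1}"

lift_definition dirac_functional :: "'k::topological_space \<Rightarrow> ('k \<Rightarrow>\<^sub>C real) \<Rightarrow>\<^sub>L real"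
  is "\<lambda>s u. apply_bcontfun u s"
  by (rule bounded_linear_intro[where K = 1]) (auto simp flip: real_norm_def intro: norm_bounded)

definition L1_adjoint ::
    "(('a \<Rightarrow> real) \<Rightarrow> 'b::real_normed_vector) \<Rightarrow> ('b \<Rightarrow>\<^sub>L real) \<Rightarrow> ('a \<Rightarrow> real) \<Rightarrow> real"
  where "L1_adjoint T \<phi> = (\<lambda>f. blinfun_apply \<phi> (T f))"

text \<open>
  The identification \<open>L\<^sub>1(M)\<^sup>* = L\<^sub>\<infinity>(M)\<close> for finite \<open>M\<close>: every bounded linear functional on
  \<open>L\<^sub>1(M)\<close> is integration against a function in \<open>Linfty M\<close>, unique up to almost everywhere
  equality; \<open>SOME\<close> picks a representative of that class.
\<close>

definition Linfty_of_functional :: "'a measure \<Rightarrow> (('a \<Rightarrow> real) \<Rightarrow> real) \<Rightarrow> 'a \<Rightarrow> real"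
  where "Linfty_of_functional M \<phi> =
    (SOME h. h \<in> Linfty M \<and> (\<forall>f. integrable M f \<longrightarrow> \<phi> f = (\<integral>x. f x * h x \<partial>M)))"

definition tendsto_in_measure ::
    "'a measure \<Rightarrow> ('s \<Rightarrow> 'a \<Rightarrow> real) \<Rightarrow> ('a \<Rightarrow> real) \<Rightarrow> 's filter \<Rightarrow> bool"
  where "tendsto_in_measure M h g F \<longleftrightarrow>
    (\<forall>\<eta>>0. ((\<lambda>s. measure M {x \<in> space M. \<bar>h s x - g x\<bar> > \<eta>}) \<longlongrightarrow> 0) F)"

text \<open>
  Continuity for the topology of convergence in measure.  The domain is an arbitrary
  topological space, so convergence is along the filter \<open>at s\<close> and not along sequences.
\<close>

definition continuous_in_measure ::
    "'a measure \<Rightarrow> ('s::topological_space \<Rightarrow> 'a \<Rightarrow> real) \<Rightarrow> bool"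
  where "continuous_in_measure M h \<longleftrightarrow> (\<forall>s. tendsto_in_measure M h (h s) (at s))"

end

theory Submission
  imports Defs
begin

text \<open>
  By Radon--Nikodym, \<open>T\<close> is given by a kernel: \<open>T u s\<close> is the integral of \<open>u * h s\<close> with
  \<open>\<bar>h s\<bar> \<le> 1\<close>. Put \<open>\<eta> = \<epsilon> / 2\<close> and let \<open>\<Phi> t\<close> be \<open>t / (1 - \<eta>)\<close> truncated to \<open>[-1, 1]\<close>, which moves
  points of \<open>[-1, 1]\<close> by at most \<open>\<eta>\<close>. As \<open>\<Phi>\<close> is Lipschitz, the kernel \<open>\<Phi> (h s)\<close> is again continuous
  in measure, and it defines \<open>S\<close>. If \<open>\<bar>T f s\<bar> > 1 - \<epsilon>\<^sup>2 / 6\<close>, then outside of the set \<open>A\<close> on which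
  \<open>\<plusminus> f * h s \<ge> (1 - \<eta>) * \<bar>f\<bar>\<close> the mass of \<open>f\<close> is less than \<open>\<epsilon>\<^sup>2 / (6 * \<eta>) = \<epsilon> / 3\<close>. On \<open>A\<close> the kernel
  of \<open>S\<close> at \<open>s\<close> is the sign of \<open>\<plusminus> f\<close>, so \<open>S\<close> attains its norm at the normalised restriction \<open>g\<close>
  of \<open>f\<close> to \<open>A\<close>.
\<close>

section \<open>The dual of \<open>L\<^sub>1\<close>\<close>

lemma L1_norm_nonneg: "0 \<le> L1_norm M f"
  by (simp add: L1_norm_def)

text \<open>All averages of \<open>h\<close> over sets of positive measure lie in the closed
  interval from \<open>-C\<close> to \<open>C\<close>, so by the averaging theorem almost all values
  do. This turns the norm bound of a functional, tested on indicators only, into an essential bound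
  of its density.\<close>

lemma (in sigma_finite_measure) AE_abs_le_if_set_integral_le:
  fixes h :: "'a \<Rightarrow> real"
  assumes "integrable M h"
    and le: "\<And>A. A \<in> sets M \<Longrightarrow> \<bar>\<integral>x. indicator A x * h x \<partial>M\<bar> \<le> C * measure M A"
  shows "AE x in M. \<bar>h x\<bar> \<le> C"
proof -
  have "AE x in M. h x \<in> {-C..C}"
  proof (rule averaging_theorem[OF \<open>integrable M h\<close>])
    fix A assume A: "A \<in> sets M" "measure M A > 0"
    show "(1 / measure M A) *\<^sub>R set_lebesgue_integral M A h \<in> {-C..C}"
      using le[OF A(1)] A(2) by (auto simp: set_lebesgue_integral_def field_simps abs_le_iff)
  qed simp
  then show ?thesis by eventually_elim auto
qed

context finite_measure
begin

lemma integrable_mult_Linfty: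
  fixes f h :: "'a \<Rightarrow> real"
  assumes "integrable M f" "h \<in> Linfty M"
  shows "integrable M (\<lambda>x. f x * h x)"
proof -
  obtain C where C: "AE x in M. \<bar>h x\<bar> \<le> C" and [measurable]: "h \<in> borel_measurable M"
    using assms(2) by (auto simp: Linfty_def)
  have [measurable]: "f \<in> borel_measurable M" using assms(1) by auto
  show ?thesis
  proof (rule Bochner_Integration.integrable_bound[where f = "\<lambda>x. C * f x"])
    show "AE x in M. norm (f x * h x) \<le> norm (C * f x)"
      using C
    proof eventually_elim
      case (elim x)
      then show ?case
        using mult_left_mono[of "\<bar>h x\<bar>" "\<bar>C\<bar>" "\<bar>f x\<bar>"] by (simp add: abs_mult mult.commute)
    qed
  qed (use assms in auto)
qed

lemma integrable_Linfty: "h \<in> Linfty M \<Longrightarrow> integrable M h"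
  using integrable_mult_Linfty[of "\<lambda>_. 1" h] by simp

lemma abs_integral_mult_le:
  fixes f h :: "'a \<Rightarrow> real"
  assumes "integrable M f" "h \<in> borel_measurable M" "AE x in M. \<bar>h x\<bar> \<le> C"
  shows "\<bar>\<integral>x. f x * h x \<partial>M\<bar> \<le> C * L1_norm M f"
proof -
  have h: "h \<in> Linfty M" using assms by (auto simp: Linfty_def)
  have "\<bar>\<integral>x. f x * h x \<partial>M\<bar> \<le> (\<integral>x. \<bar>f x * h x\<bar> \<partial>M)"
    using integral_norm_bound[of M "\<lambda>x. f x * h x"] by simp
  also have "\<dots> \<le> (\<integral>x. C * \<bar>f x\<bar> \<partial>M)"
  proof (rule integral_mono_AE)
    show "AE x in M. \<bar>f x * h x\<bar> \<le> C * \<bar>f x\<bar>"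
      using assms(3)
    proof eventually_elim
      case (elim x)
      then show ?case
        using mult_left_mono[of "\<bar>h x\<bar>" C "\<bar>f x\<bar>"] by (simp add: abs_mult mult.commute)
    qed
  qed (use assms integrable_mult_Linfty[OF assms(1) h] in auto)
  finally show ?thesis by (simp add: L1_norm_def)
qed

text \<open>Testing against indicators reduces this to uniqueness of densities. It is the uniqueness
  half of the identification of the dual with classes in \<open>Linfty M\<close>.\<close>

lemma Linfty_eq_AE:
  assumes "h \<in> Linfty M" "k \<in> Linfty M"
    and eq: "\<And>f. integrable M f \<Longrightarrow> (\<integral>x. f x * h x \<partial>M) = (\<integral>x. f x * k x \<partial>M)"
  shows "AE x in M. h x = k x"
proof (rule density_unique_real)
  fix A assume "A \<in> sets M"
  then have "integrable M (indicator A :: 'a \<Rightarrow> real)"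
    by (simp add: less_top[symmetric])
  from eq[OF this] show "set_lebesgue_integral M A h = set_lebesgue_integral M A k"
    by (simp add: set_lebesgue_integral_def)
qed (use assms integrable_Linfty in auto)

end

lemma L1_operators_add:
  "T \<in> L1_operators M \<Longrightarrow> integrable M f \<Longrightarrow> integrable M g \<Longrightarrow> T (\<lambda>x. f x + g x) = T f + T g"
  by (simp add: L1_operators_def)

lemma L1_operators_scale:
  "T \<in> L1_operators M \<Longrightarrow> integrable M f \<Longrightarrow> T (\<lambda>x. c * f x) = c *\<^sub>R T f"
  by (simp add: L1_operators_def)

lemma L1_operators_diff:
  assumes "T \<in> L1_operators M" "integrable M f" "integrable M g"
  shows "T (\<lambda>x. f x - g x) = T f - T g"
  using L1_operators_add[OF assms(1,2), of "\<lambda>x. (-1) * g x"]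
    L1_operators_scale[OF assms(1,3), of "-1"] assms(3) by simp

lemma L1_operators_bound:
  assumes "T \<in> L1_operators M"
  obtains C where "0 \<le> C" "\<And>f. integrable M f \<Longrightarrow> norm (T f) \<le> C * L1_norm M f"
proof -
  obtain C where C: "\<And>f. integrable M f \<Longrightarrow> norm (T f) \<le> C * L1_norm M f"
    using assms by (auto simp: L1_operators_def)
  have "norm (T f) \<le> max 0 C * L1_norm M f" if "integrable M f" for f
    using C[OF that] mult_right_mono[OF max.cobounded2[of C 0] L1_norm_nonneg[of M f]] by linarith
  then show ?thesis using that[of "max 0 C"] by simp
qed

text \<open>
  The set function \<open>A \<mapsto> \<phi> (indicator A) + C * \<mu> A\<close> is nonnegative, so that the Radon--Nikodym
  theorem for measures applies to it; its density exceeds the desired function by \<open>C\<close>.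
\<close>

lemma (in finite_measure) L1_functional_density:
  fixes \<phi> :: "('a \<Rightarrow> real) \<Rightarrow> real"
  assumes \<phi>: "\<phi> \<in> L1_operators M"
  obtains h where "integrable M h"
    "\<And>A. A \<in> sets M \<Longrightarrow> \<phi> (indicator A) = (\<integral>x. indicator A x * h x \<partial>M)"
proof -
  obtain C where C: "0 \<le> C" "\<And>f. integrable M f \<Longrightarrow> norm (\<phi> f) \<le> C * L1_norm M f"
    using L1_operators_bound[OF \<phi>] by metis
  define r where "r A = \<phi> (indicator A) + C * measure M A" for A
  have int: "integrable M (indicator A :: 'a \<Rightarrow> real)" if "A \<in> sets M" for A
    using that by (simp add: less_top[symmetric])
  have bnd: "\<bar>\<phi> (indicator A)\<bar> \<le> C * measure M A" if "A \<in> sets M" for A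
    using C(2)[OF int[OF that]] that by (simp add: L1_norm_def)
  \<comment> \<open>The upper bound serves twice: it gives continuity at the empty set, hence
    countable additivity, and absolute continuity of \<open>N\<close>.\<close>
  have r: "0 \<le> r A" "r A \<le> 2 * C * measure M A" if "A \<in> sets M" for A
    using bnd[OF that] by (auto simp: r_def)
  define N where "N = measure_of (space M) (sets M) (\<lambda>A. ennreal (r A))"
  have pos: "positive (sets M) (\<lambda>A. ennreal (r A))"
    using r[of "{}"] by (simp add: positive_def)
  have "additive (sets M) (\<lambda>A. ennreal (r A))"
    unfolding additive_def
  proof (intro ballI impI)
    fix A B assume AB: "A \<in> sets M" "B \<in> sets M" "A \<inter> B = {}"
    have "\<phi> (indicator (A \<union> B)) = \<phi> (\<lambda>x. indicator A x + indicator B x)"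
      using AB(3) by (intro arg_cong[of _ _ \<phi>]) (auto simp: fun_eq_iff indicator_def)
    also have "\<dots> = \<phi> (indicator A) + \<phi> (indicator B)"
      using L1_operators_add[OF \<phi> int int] AB by blast
    finally have "r (A \<union> B) = r A + r B"
      using finite_measure_Union[OF AB] by (simp add: r_def algebra_simps)
    then show "ennreal (r (A \<union> B)) = ennreal (r A) + ennreal (r B)"
      using r(1) AB by simp
  qed
  \<comment> \<open>A finitely additive, finite set function is countably additive once it tends to
    0 along sequences decreasing to the empty set; here \<open>2 * C * measure M (A i)\<close>
    dominates it.\<close>
  then have ca: "countably_additive (sets M) (\<lambda>A. ennreal (r A))"
  proof (rule sets.empty_continuous_imp_countably_additive[OF pos])
    fix A :: "nat \<Rightarrow> 'a set"
    assume A: "range A \<subseteq> sets M" "decseq A" "(\<Inter>i. A i) = {}"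
    have lim: "(\<lambda>i. 2 * C * measure M (A i)) \<longlonglongrightarrow> 2 * C * 0"
      using finite_Lim_measure_decseq[OF A(1,2)] A(3) by (intro tendsto_mult_left) simp
    have "(\<lambda>i. r (A i)) \<longlonglongrightarrow> 0"
    proof (rule Lim_null_comparison)
      show "\<forall>\<^sub>F i in sequentially. norm (r (A i)) \<le> 2 * C * measure M (A i)"
        using A(1) r by (intro always_eventually allI) (auto simp: image_subset_iff)
    qed (use lim in simp)
    from tendsto_ennrealI[OF this] show "(\<lambda>i. ennreal (r (A i))) \<longlonglongrightarrow> 0"
      by simp
  qed simp
  have sets_N: "sets N = sets M" and space_N: "space N = space M" by (simp_all add: N_def)
  have emeasure_N: "emeasure N A = ennreal (r A)" if "A \<in> sets M" for A
    using pos ca that sets.space_closed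
    by (intro emeasure_measure_of[OF N_def]) (auto simp: sets_N)
  have "finite_measure N"
    by (rule finite_measureI) (simp add: space_N emeasure_N)
  moreover have ac: "absolutely_continuous M N"
    unfolding absolutely_continuous_def
  proof
    fix A assume "A \<in> null_sets M"
    then have "A \<in> sets M" "measure M A = 0" by (auto simp: null_sets_def measure_def)
    then show "A \<in> null_sets N" using r[of A] emeasure_N[of A] by (simp add: null_sets_def sets_N)
  qed
  \<comment> \<open>Finiteness of \<open>N\<close> makes its derivative finite almost everywhere, so
    that a real-valued version \<open>D\<close> exists.\<close>
  ultimately obtain D where D[measurable]: "D \<in> borel_measurable M"
    and RN: "AE x in M. RN_deriv M N x = ennreal (D x)" and D0: "\<And>x. 0 \<le> D x"
    using real_RN_deriv[of N] sets_N by blast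
  have "N = density M (RN_deriv M N)" using density_RN_deriv[OF ac sets_N] by simp
  also have "\<dots> = density M (\<lambda>x. ennreal (D x))"
    using RN by (intro density_cong) auto
  finally have N: "N = density M D" .
  interpret N: finite_measure N by fact
  have "integrable N (\<lambda>_. 1 :: real)" by simp
  then have intD: "integrable M D"
    unfolding N using D0 by (subst (asm) integrable_real_density) auto
  show thesis
  proof (rule that[of "\<lambda>x. D x - C"])
    show "integrable M (\<lambda>x. D x - C)" using intD by simp
    fix A assume A: "A \<in> sets M"
    have "r A = measure N A" using emeasure_N[OF A] r(1)[OF A] by (simp add: measure_def)
    also have "\<dots> = (\<integral>x. indicator A x \<partial>N)" using A by (simp add: sets_N)
    also have "\<dots> = (\<integral>x. D x * indicator A x \<partial>M)"
      unfolding N using A D0 by (subst integral_real_density) auto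
    finally have "r A = (\<integral>x. D x * indicator A x \<partial>M)" .
    moreover have "integrable M (\<lambda>x. D x * indicator A x)"
      using integrable_mult_indicator[OF A intD] by (simp add: mult.commute)
    moreover have "(\<integral>x. indicator A x * (D x - C) \<partial>M) = (\<integral>x. D x * indicator A x - C * indicator A x \<partial>M)"
      by (simp add: algebra_simps)
    ultimately show "\<phi> (indicator A) = (\<integral>x. indicator A x * (D x - C) \<partial>M)"
      using int[OF A] A by (simp add: r_def)
  qed
qed

text \<open>The density found on indicators is essentially bounded by the bound \<open>C\<close> of
  the functional. Both sides are then linear and continuous for the \<open>L1_norm\<close>, and
  agreement on indicators extends to all integrable functions by induction.\<close>

lemma (in finite_measure) L1_functional_representation:
  fixes \<phi> :: "('a \<Rightarrow> real) \<Rightarrow> real"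
  assumes \<phi>: "\<phi> \<in> L1_operators M"
  obtains h where "h \<in> Linfty M" "\<And>f. integrable M f \<Longrightarrow> \<phi> f = (\<integral>x. f x * h x \<partial>M)"
proof -
  obtain h where h: "integrable M h"
    and ind: "\<And>A. A \<in> sets M \<Longrightarrow> \<phi> (indicator A) = (\<integral>x. indicator A x * h x \<partial>M)"
    using L1_functional_density[OF \<phi>] by metis
  obtain C where C: "0 \<le> C" "\<And>f. integrable M f \<Longrightarrow> norm (\<phi> f) \<le> C * L1_norm M f"
    using L1_operators_bound[OF \<phi>] by metis
  have int: "integrable M (indicator A :: 'a \<Rightarrow> real)" if "A \<in> sets M" for A
    using that by (simp add: less_top[symmetric])
  have hC: "AE x in M. \<bar>h x\<bar> \<le> C"
  proof (rule AE_abs_le_if_set_integral_le[OF h])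
    fix A assume A: "A \<in> sets M"
    show "\<bar>\<integral>x. indicator A x * h x \<partial>M\<bar> \<le> C * measure M A"
      using C(2)[OF int[OF A]] A by (simp add: ind L1_norm_def)
  qed
  have hm: "h \<in> borel_measurable M" using h by auto
  with hC have hL: "h \<in> Linfty M" by (auto simp: Linfty_def)
  have "\<phi> f = (\<integral>x. f x * h x \<partial>M)" if "integrable M f" for f
    using that
  proof induct
    case (base A c)
    have "\<phi> (\<lambda>x. c * indicator A x) = c * \<phi> (indicator A)"
      using L1_operators_scale[OF \<phi> int[OF base(1)]] by simp
    then show ?case using base by (simp add: ind mult_ac)
  next
    case (add f g)
    then show ?case
      using L1_operators_add[OF \<phi>] integrable_mult_Linfty[OF _ hL] by (simp add: distrib_right)
  next
    case (lim f s)
    \<comment> \<open>The approximants satisfy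
      \<open>\<bar>s i x\<bar> \<le> 2 * \<bar>f x\<bar>\<close>, whence the dominating function
      \<open>3 * \<bar>f x\<bar>\<close> for the differences.\<close>
    have L1: "(\<lambda>i. L1_norm M (\<lambda>x. s i x - f x)) \<longlonglongrightarrow> 0"
    proof -
      have "(\<lambda>i. \<integral>x. \<bar>s i x - f x\<bar> \<partial>M) \<longlonglongrightarrow> (\<integral>x. 0 \<partial>M)"
      proof (rule integral_dominated_convergence[where w = "\<lambda>x. 3 * \<bar>f x\<bar>"])
        show "AE x in M. (\<lambda>i. \<bar>s i x - f x\<bar>) \<longlonglongrightarrow> 0"
          using lim(3) by (auto intro!: AE_I2 tendsto_rabs_zero simp: LIM_zero_iff)
        show "AE x in M. norm \<bar>s i x - f x\<bar> \<le> 3 * \<bar>f x\<bar>" for i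
          using lim(4)[of _ i] by (intro AE_I2) (smt (verit) real_norm_def)
      qed (use lim in auto)
      then show ?thesis by (simp add: L1_norm_def)
    qed
    have "(\<lambda>i. \<phi> (s i) - \<phi> f) \<longlonglongrightarrow> 0"
    proof (rule Lim_null_comparison)
      show "\<forall>\<^sub>F i in sequentially. norm (\<phi> (s i) - \<phi> f) \<le> C * L1_norm M (\<lambda>x. s i x - f x)"
        using C(2) lim(1,5) by (auto simp: L1_operators_diff[OF \<phi>, symmetric])
      show "(\<lambda>i. C * L1_norm M (\<lambda>x. s i x - f x)) \<longlonglongrightarrow> 0"
        using tendsto_mult_right_zero[OF L1] by simp
    qed
    moreover have "(\<lambda>i. \<phi> (s i) - (\<integral>x. f x * h x \<partial>M)) \<longlonglongrightarrow> 0"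
    proof (rule Lim_null_comparison)
      have "\<phi> (s i) - (\<integral>x. f x * h x \<partial>M) = (\<integral>x. (s i x - f x) * h x \<partial>M)" for i
        using lim(1,2,5) integrable_mult_Linfty[OF _ hL] by (simp add: left_diff_distrib)
      then show "\<forall>\<^sub>F i in sequentially.
          norm (\<phi> (s i) - (\<integral>x. f x * h x \<partial>M)) \<le> C * L1_norm M (\<lambda>x. s i x - f x)"
        using abs_integral_mult_le[OF _ hm hC] lim(1,5) by simp
      show "(\<lambda>i. C * L1_norm M (\<lambda>x. s i x - f x)) \<longlonglongrightarrow> 0"
        using tendsto_mult_right_zero[OF L1] by simp
    qed
    ultimately show ?case
      unfolding LIM_zero_iff by (rule LIMSEQ_unique)
  qed
  with hL show thesis by (rule that)
qed

text \<open>The representation theorem supplies the existence that makes the \<open>SOME\<close> in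
  the definition pick a genuine density.\<close>

lemma (in finite_measure) Linfty_of_functional:
  assumes "\<phi> \<in> L1_operators M"
  shows "Linfty_of_functional M \<phi> \<in> Linfty M"
    and "integrable M f \<Longrightarrow> \<phi> f = (\<integral>x. f x * Linfty_of_functional M \<phi> x \<partial>M)"
proof -
  obtain h where "h \<in> Linfty M" "\<forall>f. integrable M f \<longrightarrow> \<phi> f = (\<integral>x. f x * h x \<partial>M)"
    using L1_functional_representation[OF assms] by metis
  then have "\<exists>h. h \<in> Linfty M \<and> (\<forall>f. integrable M f \<longrightarrow> \<phi> f = (\<integral>x. f x * h x \<partial>M))" by blast
  from someI_ex[OF this] show "Linfty_of_functional M \<phi> \<in> Linfty M"
    "integrable M f \<Longrightarrow> \<phi> f = (\<integral>x. f x * Linfty_of_functional M \<phi> x \<partial>M)"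
    by (auto simp: Linfty_of_functional_def)
qed

lemma (in finite_measure) AE_abs_Linfty_of_functional_le:
  assumes \<phi>: "\<phi> \<in> L1_operators M"
    and le: "\<And>f. integrable M f \<Longrightarrow> \<bar>\<phi> f\<bar> \<le> C * L1_norm M f"
  shows "AE x in M. \<bar>Linfty_of_functional M \<phi> x\<bar> \<le> C"
proof (rule AE_abs_le_if_set_integral_le)
  show "integrable M (Linfty_of_functional M \<phi>)"
    using Linfty_of_functional(1)[OF \<phi>] by (rule integrable_Linfty)
  fix A assume A: "A \<in> sets M"
  then have int: "integrable M (indicator A :: 'a \<Rightarrow> real)" by (simp add: less_top[symmetric])
  show "\<bar>\<integral>x. indicator A x * Linfty_of_functional M \<phi> x \<partial>M\<bar> \<le> C * measure M A"
    using le[OF int] Linfty_of_functional(2)[OF \<phi> int] A by (simp add: L1_norm_def)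
qed

lemma L1_adjoint_in_L1_operators:
  assumes T: "T \<in> L1_operators M"
  shows "L1_adjoint T \<phi> \<in> L1_operators M"
proof -
  obtain C where C: "\<And>f. integrable M f \<Longrightarrow> norm (T f) \<le> C * L1_norm M f"
    using L1_operators_bound[OF T] by metis
  have "norm (L1_adjoint T \<phi> f) \<le> norm \<phi> * C * L1_norm M f" if "integrable M f" for f
    using norm_blinfun[of \<phi> "T f"] mult_left_mono[OF C[OF that] norm_ge_zero[of \<phi>]]
    by (simp add: L1_adjoint_def mult_ac)
  then show ?thesis
    using T by (auto simp: L1_operators_def L1_adjoint_def blinfun.bilinear_simps)
qed

lemma L1_adjoint_dirac: "L1_adjoint T (dirac_functional s) f = apply_bcontfun (T f) s"
  by (simp add: L1_adjoint_def dirac_functional.rep_eq)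

section \<open>Operator norms\<close>

lemma norm_le_L1_op_norm:
  assumes T: "T \<in> L1_operators M" and f: "integrable M f"
  shows "norm (T f) \<le> L1_op_norm M T * L1_norm M f"
proof -
  obtain C where C: "0 \<le> C" "\<And>f. integrable M f \<Longrightarrow> norm (T f) \<le> C * L1_norm M f"
    using L1_operators_bound[OF T] by metis
  show ?thesis
  proof (cases "L1_norm M f = 0")
    \<comment> \<open>Such an \<open>f\<close> cannot be normalised, but the bound by
      \<open>C\<close> forces \<open>T f = 0\<close>.\<close>
    case True
    then show ?thesis using C(2)[OF f] by simp
  next
    case False
    then have pos: "L1_norm M f > 0" using L1_norm_nonneg[of M f] by simp
    define u where "u = (\<lambda>x. (1 / L1_norm M f) * f x)"
    have "L1_norm M u = 1"
      using pos by (simp add: L1_norm_def u_def abs_mult)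
    moreover have "integrable M u" using f by (simp add: u_def)
    \<comment> \<open>The set in \<open>L1_op_norm\<close> is bounded above, so its
      \<open>Sup\<close> is a real upper bound.\<close>
    moreover have "norm (T v) \<le> C" if "integrable M v" "L1_norm M v \<le> 1" for v
      using C(2)[OF that(1)] mult_left_mono[OF that(2) C(1)] by simp
    ultimately have "norm (T u) \<le> L1_op_norm M T"
      unfolding L1_op_norm_def by (intro cSup_upper) (auto intro!: bdd_aboveI)
    moreover have "T u = (1 / L1_norm M f) *\<^sub>R T f"
      unfolding u_def by (rule L1_operators_scale[OF T f])
    ultimately show ?thesis using pos by (simp add: field_simps)
  qed
qed

lemma L1_op_norm_le:
  assumes "0 \<le> C" "\<And>f. integrable M f \<Longrightarrow> norm (T f) \<le> C * L1_norm M f"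
  shows "L1_op_norm M T \<le> C"
  unfolding L1_op_norm_def
proof (rule cSup_least)
  have "integrable M (\<lambda>_. 0 :: real) \<and> L1_norm M (\<lambda>_. 0) \<le> 1" by (simp add: L1_norm_def)
  then show "{norm (T f) |f. integrable M f \<and> L1_norm M f \<le> 1} \<noteq> {}" by blast
  fix y assume "y \<in> {norm (T f) |f. integrable M f \<and> L1_norm M f \<le> 1}"
  then obtain f where "y = norm (T f)" "integrable M f" "L1_norm M f \<le> 1" by blast
  then show "y \<le> C" using assms(2)[of f] mult_left_mono[OF _ assms(1), of "L1_norm M f" 1] by simp
qed

section \<open>Kernels that are continuous in measure\<close>

text \<open>Up to a null set, a deviation of \<open>k s\<close> beyond \<open>\<eta>\<close> forces
  one of \<open>h s\<close> beyond \<open>\<eta> / L\<close>. The null set may depend on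
  \<open>s\<close>, as only measures are compared. The lemma serves both for truncating a kernel and
  for changing its representatives.\<close>

lemma (in finite_measure) tendsto_in_measure_lipschitz:
  assumes h: "tendsto_in_measure M h g F" and "0 < L"
    and [measurable]: "\<And>s. h s \<in> borel_measurable M" "g \<in> borel_measurable M"
      "\<And>s. k s \<in> borel_measurable M" "l \<in> borel_measurable M"
    and le: "\<And>s. AE x in M. \<bar>k s x - l x\<bar> \<le> L * \<bar>h s x - g x\<bar>"
  shows "tendsto_in_measure M k l F"
  unfolding tendsto_in_measure_def
proof (intro allI impI)
  fix \<eta> :: real assume "\<eta> > 0"
  show "((\<lambda>s. measure M {x \<in> space M. \<bar>k s x - l x\<bar> > \<eta>}) \<longlongrightarrow> 0) F"
  proof (rule Lim_null_comparison)
    show "((\<lambda>s. measure M {x \<in> space M. \<bar>h s x - g x\<bar> > \<eta> / L}) \<longlongrightarrow> 0) F"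
      using h \<open>\<eta> > 0\<close> \<open>0 < L\<close> by (simp add: tendsto_in_measure_def)
    have "measure M {x \<in> space M. \<bar>k s x - l x\<bar> > \<eta>} \<le> measure M {x \<in> space M. \<bar>h s x - g x\<bar> > \<eta> / L}"
      for s
    proof (rule finite_measure_mono_AE)
      show "AE x in M. x \<in> {x \<in> space M. \<bar>k s x - l x\<bar> > \<eta>} \<longrightarrow>
          x \<in> {x \<in> space M. \<bar>h s x - g x\<bar> > \<eta> / L}"
        using le[of s] by eventually_elim (use \<open>0 < L\<close> in \<open>auto simp: field_simps\<close>)
    qed measurable
    then show "\<forall>\<^sub>F s in F. norm (measure M {x \<in> space M. \<bar>k s x - l x\<bar> > \<eta>})
        \<le> measure M {x \<in> space M. \<bar>h s x - g x\<bar> > \<eta> / L}"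
      by simp
  qed
qed

text \<open>At each point the integrand vanishes as soon as \<open>n\<close> reaches
  \<open>\<bar>u x\<bar>\<close>, and \<open>\<bar>u\<bar>\<close> dominates.\<close>

lemma integrable_truncation_tail:
  fixes u :: "'a \<Rightarrow> real"
  assumes u: "integrable M u" and "0 < e"
  obtains n :: nat where "(\<integral>x. \<bar>u x\<bar> * indicator {x. \<bar>u x\<bar> > n} x \<partial>M) < e"
proof -
  have [measurable]: "u \<in> borel_measurable M" using u by auto
  have "(\<lambda>n. \<integral>x. \<bar>u x\<bar> * indicator {x. \<bar>u x\<bar> > real n} x \<partial>M) \<longlonglongrightarrow> (\<integral>x. 0 \<partial>M)"
  proof (rule integral_dominated_convergence[where w = "\<lambda>x. \<bar>u x\<bar>"])
    show "AE x in M. (\<lambda>n. \<bar>u x\<bar> * indicator {x. \<bar>u x\<bar> > real n} x) \<longlonglongrightarrow> 0"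
    proof (intro AE_I2 tendsto_eventually)
      fix x
      obtain m :: nat where "\<bar>u x\<bar> \<le> m" using real_arch_simple by blast
      then show "\<forall>\<^sub>F n in sequentially. \<bar>u x\<bar> * indicator {x. \<bar>u x\<bar> > real n} x = 0"
        by (intro eventually_sequentiallyI[of m]) (auto simp: indicator_def)
    qed
  qed (use u in \<open>auto simp: indicator_def\<close>)
  then have "\<forall>\<^sub>F n in sequentially. (\<integral>x. \<bar>u x\<bar> * indicator {x. \<bar>u x\<bar> > real n} x \<partial>M) < e"
    using order_tendstoD(2)[OF _ \<open>0 < e\<close>] by simp
  then show thesis using that by (auto simp: eventually_sequentially)
qed

text \<open>The filter is arbitrary, so the difference is estimated directly instead of along
  sequences. Where \<open>\<bar>u x\<bar> > n\<close>, the kernels differ by at most 2 and the tail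
  of \<open>u\<close> is small; on the set \<open>B s\<close> of large deviation the integrand is at
  most \<open>2 * n\<close> and the measure is small; elsewhere it is at most
  \<open>n * \<eta>\<close>.\<close>

lemma (in finite_measure) tendsto_integral_in_measure:
  fixes u :: "'a \<Rightarrow> real"
  assumes u: "integrable M u" and k: "tendsto_in_measure M k l F"
    and km[measurable]: "\<And>s. k s \<in> borel_measurable M" and lm[measurable]: "l \<in> borel_measurable M"
    and k1: "\<And>s. AE x in M. \<bar>k s x\<bar> \<le> 1" and l1: "AE x in M. \<bar>l x\<bar> \<le> 1"
  shows "((\<lambda>s. \<integral>x. u x * k s x \<partial>M) \<longlongrightarrow> (\<integral>x. u x * l x \<partial>M)) F"
proof (rule tendstoI)
  fix e :: real assume "0 < e"
  have [measurable]: "u \<in> borel_measurable M" using u by auto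
  have kL: "k s \<in> Linfty M" and lL: "l \<in> Linfty M" for s
    using km lm k1 l1 by (auto simp: Linfty_def)
  obtain n :: nat where n: "(\<integral>x. \<bar>u x\<bar> * indicator {x. \<bar>u x\<bar> > n} x \<partial>M) < e / 8"
    using integrable_truncation_tail[OF u, of "e / 8"] \<open>0 < e\<close> by auto
  \<comment> \<open>This keeps \<open>n * \<eta> * measure M (space M)\<close> at most
    \<open>e / 4\<close>; the added ones make the denominator positive. Each of the three regions
    then contributes at most \<open>e / 4\<close>.\<close>
  define \<eta> where "\<eta> = e / (4 * (real n + 1) * (measure M (space M) + 1))"
  have den: "(real n + 1) * (measure M (space M) + 1) > 0"
    by (simp add: add_nonneg_pos)
  have "\<eta> > 0" unfolding \<eta>_def mult.assoc using \<open>0 < e\<close> den by (intro divide_pos_pos) simp_all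
  define B where "B s = {x \<in> space M. \<bar>k s x - l x\<bar> > \<eta>}" for s
  have B[measurable]: "B s \<in> sets M" for s unfolding B_def by measurable
  have "((\<lambda>s. 2 * real n * measure M (B s)) \<longlongrightarrow> 2 * real n * 0) F"
    using k \<open>\<eta> > 0\<close> by (intro tendsto_mult_left) (simp add: tendsto_in_measure_def B_def)
  then have "\<forall>\<^sub>F s in F. 2 * real n * measure M (B s) < e / 4"
    using \<open>0 < e\<close> by (intro order_tendstoD) auto
  then show "\<forall>\<^sub>F s in F. dist (\<integral>x. u x * k s x \<partial>M) (\<integral>x. u x * l x \<partial>M) < e"
  proof eventually_elim
    fix s assume s: "2 * real n * measure M (B s) < e / 4"
    define t where "t x = \<bar>u x\<bar> * indicator {x. \<bar>u x\<bar> > n} x" for x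
    have t: "integrable M t"
      by (rule Bochner_Integration.integrable_bound[OF u]) (auto simp: t_def[abs_def] indicator_def)
    have "dist (\<integral>x. u x * k s x \<partial>M) (\<integral>x. u x * l x \<partial>M) = \<bar>\<integral>x. u x * (k s x - l x) \<partial>M\<bar>"
      using integrable_mult_Linfty[OF u kL] integrable_mult_Linfty[OF u lL]
      by (simp add: dist_real_def right_diff_distrib)
    also have "\<dots> \<le> (\<integral>x. \<bar>u x * (k s x - l x)\<bar> \<partial>M)"
      using integral_norm_bound[of M "\<lambda>x. u x * (k s x - l x)"] by simp
    also have "\<dots> \<le> (\<integral>x. 2 * t x + (2 * real n * indicator (B s) x + real n * \<eta>) \<partial>M)"
    proof (rule integral_mono_AE)
      show "integrable M (\<lambda>x. \<bar>u x * (k s x - l x)\<bar>)"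
        using integrable_mult_Linfty[OF u kL] integrable_mult_Linfty[OF u lL]
        by (simp add: right_diff_distrib)
      show "AE x in M. \<bar>u x * (k s x - l x)\<bar> \<le>
          2 * t x + (2 * real n * indicator (B s) x + real n * \<eta>)"
        using k1[of s] l1 AE_space
      proof eventually_elim
        fix x assume x: "\<bar>k s x\<bar> \<le> 1" "\<bar>l x\<bar> \<le> 1" "x \<in> space M"
        then have 2: "\<bar>k s x - l x\<bar> \<le> 2" by linarith
        have n0: "0 \<le> real n * \<eta>" using \<open>\<eta> > 0\<close> by simp
        consider "\<bar>u x\<bar> > n" | "\<bar>u x\<bar> \<le> n" "x \<in> B s" | "\<bar>u x\<bar> \<le> n" "x \<notin> B s" by linarith
        then show "\<bar>u x * (k s x - l x)\<bar> \<le>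
            2 * t x + (2 * real n * indicator (B s) x + real n * \<eta>)"
        proof cases
          case 1
          then show ?thesis using mult_left_mono[OF 2, of "\<bar>u x\<bar>"] n0
            by (simp add: t_def abs_mult indicator_def)
        next
          case 2
          then show ?thesis using mult_mono[OF 2(1) \<open>\<bar>k s x - l x\<bar> \<le> 2\<close>] n0
            by (simp add: t_def abs_mult)
        next
          case 3
          then have "\<bar>k s x - l x\<bar> \<le> \<eta>" using x by (auto simp: B_def)
          then show ?thesis using mult_mono[OF 3(1)] 3
            by (simp add: t_def abs_mult)
        qed
      qed
    qed (use t B in \<open>auto simp: less_top[symmetric]\<close>)
    also have "\<dots> = 2 * (\<integral>x. t x \<partial>M) + (2 * real n * measure M (B s) + real n * \<eta> * measure M (space M))"
      using t B by (simp add: less_top[symmetric] mult_ac)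
    also have "\<dots> < e"
    proof -
      have "real n * measure M (space M) \<le> (real n + 1) * (measure M (space M) + 1)"
        by (intro mult_mono) auto
      then have "real n * measure M (space M) * \<eta> \<le> (real n + 1) * (measure M (space M) + 1) * \<eta>"
        using \<open>\<eta> > 0\<close> by (intro mult_right_mono) simp_all
      also have "\<dots> = e / 4"
        unfolding \<eta>_def mult.assoc using den by (simp only: mult.assoc[symmetric]) (simp add: field_simps)
      finally have "real n * \<eta> * measure M (space M) \<le> e / 4" by (simp add: mult_ac)
      then show ?thesis using s n \<open>0 < e\<close> unfolding t_def by linarith
    qed
    finally show "dist (\<integral>x. u x * k s x \<partial>M) (\<integral>x. u x * l x \<partial>M) < e" .
  qed
qed

text \<open>Only integrable \<open>u\<close> matter. For these, \<open>kernel_operator_apply\<close>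
  shows that the function under \<open>Bcontfun\<close> is bounded and continuous when the kernel
  satisfies the conditions of the locale below.\<close>

definition kernel_operator ::
    "'a measure \<Rightarrow> ('k::topological_space \<Rightarrow> 'a \<Rightarrow> real) \<Rightarrow> ('a \<Rightarrow> real) \<Rightarrow> ('k \<Rightarrow>\<^sub>C real)"
  where "kernel_operator M k u = Bcontfun (\<lambda>s. \<integral>x. u x * k s x \<partial>M)"

locale measure_continuous_kernel = finite_measure M for M :: "'a measure" +
  fixes k :: "'k::topological_space \<Rightarrow> 'a \<Rightarrow> real"
  assumes measurable_kernel: "\<And>s. k s \<in> borel_measurable M"
    and AE_abs_kernel_le: "\<And>s. AE x in M. \<bar>k s x\<bar> \<le> 1"
    and continuous_kernel: "continuous_in_measure M k"
begin

lemma kernel_Linfty: "k s \<in> Linfty M"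
  using measurable_kernel AE_abs_kernel_le by (auto simp: Linfty_def)

text \<open>Continuity in measure together with the uniform bound 1 on the kernel makes the
  integrals continuous in \<open>s\<close>; the same bound makes them bounded by
  \<open>L1_norm M u\<close>.\<close>

lemma kernel_operator_apply:
  assumes "integrable M u"
  shows "apply_bcontfun (kernel_operator M k u) s = (\<integral>x. u x * k s x \<partial>M)"
proof -
  have "(\<lambda>s. \<integral>x. u x * k s x \<partial>M) \<in> bcontfun"
  proof (rule bcontfun_normI)
    have "((\<lambda>s. \<integral>x. u x * k s x \<partial>M) \<longlongrightarrow> (\<integral>x. u x * k s x \<partial>M)) (at s)" for s
      using continuous_kernel measurable_kernel AE_abs_kernel_le
      by (intro tendsto_integral_in_measure[OF assms]) (auto simp: continuous_in_measure_def)
    then show "continuous_on UNIV (\<lambda>s. \<integral>x. u x * k s x \<partial>M)"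
      by (simp add: continuous_on_def)
    show "norm (\<integral>x. u x * k s x \<partial>M) \<le> 1 * L1_norm M u" for s
      using abs_integral_mult_le[OF assms measurable_kernel AE_abs_kernel_le] by simp
  qed
  then show ?thesis by (simp add: kernel_operator_def Bcontfun_inverse)
qed

lemma norm_kernel_operator_le:
  assumes "integrable M u"
  shows "norm (kernel_operator M k u) \<le> L1_norm M u"
  using abs_integral_mult_le[OF assms measurable_kernel AE_abs_kernel_le]
  by (intro norm_bound) (simp add: kernel_operator_apply[OF assms])

lemma kernel_operator_in_L1_operators: "kernel_operator M k \<in> L1_operators M"
proof -
  have "kernel_operator M k (\<lambda>x. f x + g x) = kernel_operator M k f + kernel_operator M k g"
    if "integrable M f" "integrable M g" for f g
    using that integrable_mult_Linfty[OF _ kernel_Linfty]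
    by (intro bcontfun_eqI) (simp add: kernel_operator_apply plus_bcontfun.rep_eq distrib_right)
  moreover have "kernel_operator M k (\<lambda>x. c * f x) = c *\<^sub>R kernel_operator M k f"
    if "integrable M f" for f c
    using that by (intro bcontfun_eqI)
      (simp add: kernel_operator_apply scaleR_bcontfun.rep_eq mult.assoc)
  moreover have "\<exists>C. \<forall>f. integrable M f \<longrightarrow> norm (kernel_operator M k f) \<le> C * L1_norm M f"
    using norm_kernel_operator_le by (intro exI[of _ 1]) simp
  ultimately show ?thesis by (simp add: L1_operators_def)
qed

text \<open>Both functions represent the same functional. The choice made by \<open>SOME\<close> may
  still differ from \<open>k s\<close> on a null set that depends on \<open>s\<close>.\<close>

lemma Linfty_of_functional_kernel_operator:
  "AE x in M. Linfty_of_functional M (L1_adjoint (kernel_operator M k) (dirac_functional s)) x = k s x"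
proof (rule Linfty_eq_AE[OF _ kernel_Linfty])
  note adj = L1_adjoint_in_L1_operators[OF kernel_operator_in_L1_operators, of "dirac_functional s"]
  show "Linfty_of_functional M (L1_adjoint (kernel_operator M k) (dirac_functional s)) \<in> Linfty M"
    by (rule Linfty_of_functional(1)[OF adj])
  show "(\<integral>x. f x * Linfty_of_functional M (L1_adjoint (kernel_operator M k) (dirac_functional s)) x \<partial>M)
      = (\<integral>x. f x * k s x \<partial>M)" if "integrable M f" for f
    using Linfty_of_functional(2)[OF adj that] that by (simp add: L1_adjoint_dirac kernel_operator_apply)
qed

lemma continuous_in_measure_kernel_operator:
  "continuous_in_measure M
    (\<lambda>s. Linfty_of_functional M (L1_adjoint (kernel_operator M k) (dirac_functional s)))"
  unfolding continuous_in_measure_def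
proof
  fix s
  let ?h = "\<lambda>s. Linfty_of_functional M (L1_adjoint (kernel_operator M k) (dirac_functional s))"
  have h: "?h s \<in> borel_measurable M" for s
    using Linfty_of_functional(1)[OF L1_adjoint_in_L1_operators[OF kernel_operator_in_L1_operators]]
    by (simp add: Linfty_def)
  show "tendsto_in_measure M ?h (?h s) (at s)"
  proof (rule tendsto_in_measure_lipschitz[where L = 1 and h = k and g = "k s"])
    show "AE x in M. \<bar>?h s' x - ?h s x\<bar> \<le> 1 * \<bar>k s' x - k s x\<bar>" for s'
      using Linfty_of_functional_kernel_operator[of s] Linfty_of_functional_kernel_operator[of s']
      by eventually_elim simp
  qed (use continuous_kernel measurable_kernel h in \<open>auto simp: continuous_in_measure_def\<close>)
qed

end

section \<open>Truncating the kernel\<close>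

definition trunc :: "real \<Rightarrow> real \<Rightarrow> real"
  where "trunc \<eta> t = max (-1) (min 1 (t / (1 - \<eta>)))"

lemma borel_measurable_trunc [measurable]: "trunc \<eta> \<in> borel_measurable borel"
  unfolding trunc_def by measurable

lemma abs_trunc_le: "\<bar>trunc \<eta> t\<bar> \<le> 1"
  by (auto simp: trunc_def)

text \<open>Clipping to an interval is nonexpansive, so the only factor comes from the
  rescaling.\<close>

lemma trunc_lipschitz:
  assumes "\<eta> < 1"
  shows "\<bar>trunc \<eta> t - trunc \<eta> t'\<bar> \<le> 1 / (1 - \<eta>) * \<bar>t - t'\<bar>"
proof -
  have "\<bar>trunc \<eta> t - trunc \<eta> t'\<bar> \<le> \<bar>t / (1 - \<eta>) - t' / (1 - \<eta>)\<bar>"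
    unfolding trunc_def by linarith
  also have "\<dots> = 1 / (1 - \<eta>) * \<bar>t - t'\<bar>"
    using assms by (simp add: diff_divide_distrib[symmetric] abs_divide)
  finally show ?thesis .
qed

text \<open>Where no clipping occurs, the rescaled value \<open>q\<close> exceeds \<open>t\<close>
  by \<open>\<eta> * q\<close> with \<open>\<bar>q\<bar> \<le> 1\<close>. Where clipping occurs,
  \<open>t\<close> already lies within \<open>\<eta>\<close> of the endpoint to which it is
  sent.\<close>

lemma abs_trunc_diff_le:
  assumes "0 \<le> \<eta>" "\<eta> < 1" "\<bar>t\<bar> \<le> 1"
  shows "\<bar>trunc \<eta> t - t\<bar> \<le> \<eta>"
proof -
  define q where "q = t / (1 - \<eta>)"
  have "t = (1 - \<eta>) * q" using assms(2) by (simp add: q_def)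
  then have t: "t = q - \<eta> * q" by (simp add: left_diff_distrib)
  consider "\<bar>q\<bar> \<le> 1" | "q > 1" | "q < -1" by linarith
  then show ?thesis
  proof cases
    case 1
    then have "trunc \<eta> t = q" by (simp add: trunc_def q_def[symmetric])
    then have "trunc \<eta> t - t = \<eta> * q" using t by simp
    then show ?thesis using 1 assms(1) mult_left_mono[OF 1 assms(1)] by (simp add: abs_mult)
  next
    case 2
    then have "trunc \<eta> t = 1" "t > 1 - \<eta>"
      using assms(2) by (auto simp: trunc_def q_def field_simps)
    then show ?thesis using assms(3) by linarith
  next
    case 3
    then have "trunc \<eta> t = -1" "t < -(1 - \<eta>)"
      using assms(2) by (auto simp: trunc_def q_def field_simps)
    then show ?thesis using assms(3) by linarith
  qed
qed

text \<open>For nonzero \<open>y\<close> the hypothesis says that \<open>t\<close> has the sign of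
  \<open>y\<close> and modulus at least \<open>1 - \<eta>\<close>, so the truncation saturates at
  that sign.\<close>

lemma mult_trunc_eq_abs:
  assumes "\<eta> < 1" "(1 - \<eta>) * \<bar>y\<bar> \<le> y * t"
  shows "y * trunc \<eta> t = \<bar>y\<bar>"
proof -
  consider "y = 0" | "y > 0" | "y < 0" by linarith
  then show ?thesis
  proof cases
    case 2
    then have "1 - \<eta> \<le> t" using assms(2) by (simp add: mult.commute)
    then show ?thesis using 2 assms(1) by (simp add: trunc_def)
  next
    case 3
    then have "t \<le> -(1 - \<eta>)"
      using assms(2) mult_le_cancel_left_pos[of "-y" "1 - \<eta>" "-t"] by (simp add: mult.commute)
    then have "t / (1 - \<eta>) \<le> -1" using assms(1) by (simp add: field_simps)
    then show ?thesis using 3 by (simp add: trunc_def)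
  qed simp
qed

section \<open>Construction of the norm-attaining operator and function\<close>

theorem theorem5p2:
  fixes M :: "'a measure"
    and T :: "('a \<Rightarrow> real) \<Rightarrow> ('k::t2_space \<Rightarrow>\<^sub>C real)"
    and f :: "'a \<Rightarrow> real"
    and \<epsilon> :: real
  assumes "finite_measure M"
    and "compact (UNIV :: 'k set)"
    and "0 < \<epsilon>" and "\<epsilon> < 1"
    and "T \<in> L1_operators M" and "L1_op_norm M T = 1"
    and "continuous_in_measure M
           (\<lambda>s. Linfty_of_functional M (L1_adjoint T (dirac_functional s)))"
    and "integrable M f" and "L1_norm M f = 1"
    and "norm (T f) > 1 - \<epsilon>\<^sup>2 / 6"
  shows "\<exists>(S :: ('a \<Rightarrow> real) \<Rightarrow> ('k \<Rightarrow>\<^sub>C real)) (g :: 'a \<Rightarrow> real).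
           S \<in> L1_operators M \<and> L1_op_norm M S = 1 \<and>
           integrable M g \<and> L1_norm M g = 1 \<and>
           norm (S g) = 1 \<and>
           L1_op_norm M (\<lambda>u. S u - T u) < \<epsilon> \<and>
           L1_norm M (\<lambda>x. f x - g x) < \<epsilon> \<and>
           continuous_in_measure M
             (\<lambda>s. Linfty_of_functional M (L1_adjoint S (dirac_functional s)))"
proof -
  interpret finite_measure M by fact
  note T = \<open>T \<in> L1_operators M\<close> and f = \<open>integrable M f\<close>
  have [measurable]: "f \<in> borel_measurable M" using f by auto
  define \<eta> where "\<eta> = \<epsilon> / 2"
  have \<eta>: "0 < \<eta>" "\<eta> < 1" using \<open>0 < \<epsilon>\<close> \<open>\<epsilon> < 1\<close> by (auto simp: \<eta>_def)
  define h where "h s = Linfty_of_functional M (L1_adjoint T (dirac_functional s))" for s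
  note adj = L1_adjoint_in_L1_operators[OF T]
  have h_Linfty: "h s \<in> Linfty M" for s
    unfolding h_def by (rule Linfty_of_functional(1)[OF adj])
  then have h_meas[measurable]: "h s \<in> borel_measurable M" for s by (simp add: Linfty_def)
  have T_apply: "apply_bcontfun (T u) s = (\<integral>x. u x * h s x \<partial>M)" if "integrable M u" for u s
    using Linfty_of_functional(2)[OF adj[of "dirac_functional s"] that]
    by (simp add: L1_adjoint_dirac h_def)
  have T_le: "\<bar>apply_bcontfun (T u) s\<bar> \<le> L1_norm M u" if "integrable M u" for u s
    using norm_le_L1_op_norm[OF T that] norm_bounded[of "T u" s] \<open>L1_op_norm M T = 1\<close> by simp
  have h_le: "AE x in M. \<bar>h s x\<bar> \<le> 1" for s
    unfolding h_def by (rule AE_abs_Linfty_of_functional_le[OF adj]) (simp add: L1_adjoint_dirac T_le)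
  define k where "k s x = trunc \<eta> (h s x)" for s x
  interpret measure_continuous_kernel M k
  proof
    show k: "k s \<in> borel_measurable M" for s unfolding k_def[abs_def] by measurable
    show "AE x in M. \<bar>k s x\<bar> \<le> 1" for s by (simp add: k_def abs_trunc_le)
    show "continuous_in_measure M k"
      unfolding continuous_in_measure_def
    proof
      fix s
      show "tendsto_in_measure M k (k s) (at s)"
      proof (rule tendsto_in_measure_lipschitz[where h = h and g = "h s" and L = "1 / (1 - \<eta>)"])
        show "tendsto_in_measure M h (h s) (at s)"
          using assms(7) by (simp add: continuous_in_measure_def h_def[abs_def])
        show "AE x in M. \<bar>k s' x - k s x\<bar> \<le> 1 / (1 - \<eta>) * \<bar>h s' x - h s x\<bar>" for s'
          unfolding k_def by (intro AE_I2 trunc_lipschitz \<eta>)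
      qed (use \<eta> k in auto)
    qed
  qed
  let ?S = "kernel_operator M k"
  \<comment> \<open>Were there no such point, the supremum norm of \<open>T f\<close> would not
    exceed the threshold.\<close>
  obtain s where s: "\<bar>apply_bcontfun (T f) s\<bar> > 1 - \<epsilon>\<^sup>2 / 6"
    using norm_bound[of "T f" "1 - \<epsilon>\<^sup>2 / 6"] assms(10) by (force simp: not_le[symmetric])
  \<comment> \<open>The factor \<open>\<sigma>\<close> treats positive and negative values of
    \<open>T f\<close> at \<open>s\<close> alike; it has modulus 1 because the threshold is
    positive.\<close>
  define \<sigma> where "\<sigma> = sgn (apply_bcontfun (T f) s)"
  have "\<epsilon>\<^sup>2 < 6" using power_strict_mono[OF \<open>\<epsilon> < 1\<close>, of 2] \<open>0 < \<epsilon>\<close> by simp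
  then have "apply_bcontfun (T f) s \<noteq> 0" using s by auto
  then have \<sigma>: "\<bar>\<sigma>\<bar> = 1" by (simp add: \<sigma>_def abs_sgn_eq)
  define A where "A = {x \<in> space M. (1 - \<eta>) * \<bar>f x\<bar> \<le> \<sigma> * f x * h s x}"
  have A[measurable]: "A \<in> sets M" unfolding A_def by measurable
  have int_ind: "integrable M (\<lambda>x. \<bar>f x\<bar> * indicator B x)" if "B \<in> sets M" for B
    using integrable_mult_indicator[OF that integrable_abs[OF f]] by (simp add: mult.commute)
  define m where "m = (\<integral>x. \<bar>f x\<bar> * indicator A x \<partial>M)"
  have compl: "(\<integral>x. \<bar>f x\<bar> * indicator (space M - A) x \<partial>M) = 1 - m"
  proof -
    have "(\<integral>x. \<bar>f x\<bar> * indicator A x \<partial>M) + (\<integral>x. \<bar>f x\<bar> * indicator (space M - A) x \<partial>M)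
        = (\<integral>x. \<bar>f x\<bar> * indicator A x + \<bar>f x\<bar> * indicator (space M - A) x \<partial>M)"
      using int_ind A by simp
    also have "\<dots> = L1_norm M f"
      unfolding L1_norm_def by (rule Bochner_Integration.integral_cong) (auto simp: indicator_def)
    finally show ?thesis using \<open>L1_norm M f = 1\<close> by (simp add: m_def)
  qed
  have "1 - \<epsilon>\<^sup>2 / 6 < \<sigma> * apply_bcontfun (T f) s"
    using s by (simp add: \<sigma>_def abs_sgn mult.commute)
  also have "\<dots> = (\<integral>x. \<sigma> * (f x * h s x) \<partial>M)"
    by (simp add: T_apply[OF f])
  \<comment> \<open>On \<open>A\<close> the bound \<open>\<bar>h s x\<bar> \<le> 1\<close> is used;
    off \<open>A\<close> the failure of the defining inequality costs at least
    \<open>\<eta> * \<bar>f x\<bar>\<close>. Nearly full mass of the integral therefore limits the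
    mass \<open>1 - m\<close> of \<open>f\<close> off \<open>A\<close>.\<close>
  also have "\<dots> \<le> (\<integral>x. \<bar>f x\<bar> - \<eta> * (\<bar>f x\<bar> * indicator (space M - A) x) \<partial>M)"
  proof (rule integral_mono_AE)
    show "AE x in M. \<sigma> * (f x * h s x) \<le> \<bar>f x\<bar> - \<eta> * (\<bar>f x\<bar> * indicator (space M - A) x)"
      using h_le[of s] AE_space
    proof eventually_elim
      case (elim x)
      have "\<sigma> * (f x * h s x) \<le> \<bar>f x\<bar>"
        using mult_left_mono[OF elim(1), of "\<bar>f x\<bar>"] abs_ge_self[of "\<sigma> * (f x * h s x)"] \<sigma>
        by (simp add: abs_mult)
      then show ?case using elim(2) by (auto simp: A_def indicator_def algebra_simps)
    qed
  qed (use f integrable_mult_Linfty[OF f h_Linfty] int_ind A in auto)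
  also have "\<dots> = 1 - \<eta> * (1 - m)"
    using f int_ind[of "space M - A"] A \<open>L1_norm M f = 1\<close> by (simp add: compl L1_norm_def)
  finally have "\<epsilon> * (1 - m) < \<epsilon> * (\<epsilon> / 3)"
    by (simp add: \<eta>_def power2_eq_square)
  then have m: "1 - m < \<epsilon> / 3" using \<open>0 < \<epsilon>\<close> by simp
  then have "0 < m" using \<open>\<epsilon> < 1\<close> by simp
  have "0 \<le> 1 - m" unfolding compl[symmetric] by simp
  \<comment> \<open>Restricting to \<open>A\<close> leaves mass \<open>m > 0\<close>, and the factor
    restores norm one.\<close>
  define g where "g x = 1 / m * (f x * indicator A x)" for x
  have g: "integrable M g"
    unfolding g_def[abs_def]
    using integrable_mult_indicator[OF A f] by (simp add: mult.commute)
  have abs_g: "\<bar>g x\<bar> = 1 / m * (\<bar>f x\<bar> * indicator A x)" for x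
    using \<open>0 < m\<close> by (simp add: g_def abs_mult)
  have norm_g: "L1_norm M g = 1"
    using \<open>0 < m\<close> by (simp add: L1_norm_def abs_g m_def[symmetric])
  \<comment> \<open>On \<open>A\<close> the truncated kernel equals the sign of
    \<open>\<sigma> * f x\<close> wherever \<open>f x\<close> is nonzero; off \<open>A\<close> both
    sides vanish. Integration shows that \<open>?S g\<close> has modulus 1 at \<open>s\<close>, the
    largest value that a contraction allows.\<close>
  have "\<sigma> * g x * k s x = \<bar>g x\<bar>" if "x \<in> space M" for x
  proof (cases "x \<in> A")
    case True
    then have "\<sigma> * f x * k s x = \<bar>\<sigma> * f x\<bar>"
      unfolding k_def using \<eta> \<sigma> by (intro mult_trunc_eq_abs) (auto simp: A_def abs_mult)
    then show ?thesis using True \<sigma> unfolding abs_g by (simp add: g_def abs_mult)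
  qed (simp add: g_def)
  then have "(\<integral>x. \<sigma> * g x * k s x \<partial>M) = 1"
    using norm_g by (simp add: L1_norm_def cong: Bochner_Integration.integral_cong)
  then have "\<sigma> * apply_bcontfun (?S g) s = 1"
    by (simp add: kernel_operator_apply[OF g] mult.assoc)
  then have "\<bar>apply_bcontfun (?S g) s\<bar> = 1"
    using \<sigma> by (metis abs_mult abs_one mult_1)
  then have norm_Sg: "norm (?S g) = 1"
    using norm_bounded[of "?S g" s] norm_kernel_operator_le[OF g] norm_g by simp
  have "L1_op_norm M ?S \<le> 1"
    using norm_kernel_operator_le by (intro L1_op_norm_le) auto
  moreover have "1 \<le> L1_op_norm M ?S"
    using norm_le_L1_op_norm[OF kernel_operator_in_L1_operators g] norm_Sg norm_g by simp
  \<comment> \<open>The kernels at each point differ by at most \<open>\<eta>\<close> almost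
    everywhere, and \<open>\<eta> = \<epsilon> / 2\<close> leaves the strict inequality.\<close>
  moreover have "L1_op_norm M (\<lambda>u. ?S u - T u) \<le> \<eta>"
  proof (rule L1_op_norm_le)
    fix u :: "'a \<Rightarrow> real"
    assume u: "integrable M u"
    show "norm (?S u - T u) \<le> \<eta> * L1_norm M u"
    proof (rule norm_bound)
      fix s
      have "apply_bcontfun (?S u - T u) s = (\<integral>x. u x * (k s x - h s x) \<partial>M)"
        using integrable_mult_Linfty[OF u kernel_Linfty] integrable_mult_Linfty[OF u h_Linfty]
        by (simp add: minus_bcontfun.rep_eq kernel_operator_apply[OF u] T_apply[OF u] right_diff_distrib)
      moreover have "AE x in M. \<bar>k s x - h s x\<bar> \<le> \<eta>"
        using h_le[of s] by eventually_elim (use \<eta> in \<open>simp add: k_def abs_trunc_diff_le\<close>)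
      ultimately show "norm (apply_bcontfun (?S u - T u) s) \<le> \<eta> * L1_norm M u"
        using abs_integral_mult_le[OF u _ \<open>AE x in M. \<bar>k s x - h s x\<bar> \<le> \<eta>\<close>] measurable_kernel by simp
    qed
  qed (use \<eta> in simp)
  moreover have "L1_norm M (\<lambda>x. f x - g x) < \<epsilon>"
  proof -
    \<comment> \<open>Two equal losses occur: the mass \<open>1 - m\<close> removed off
      \<open>A\<close>, and the mass \<open>(1 / m - 1) * m\<close> added on \<open>A\<close> by
      normalising. Their sum \<open>2 * (1 - m)\<close> is below
      \<open>2 * \<epsilon> / 3\<close>.\<close>
    have "L1_norm M (\<lambda>x. f x - g x) =
        (\<integral>x. \<bar>f x\<bar> * indicator (space M - A) x + (1 / m - 1) * (\<bar>f x\<bar> * indicator A x) \<partial>M)"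
      unfolding L1_norm_def
    proof (rule Bochner_Integration.integral_cong)
      fix x assume "x \<in> space M"
      have "\<bar>f x - 1 / m * f x\<bar> = (1 / m - 1) * \<bar>f x\<bar>"
      proof -
        have "f x - 1 / m * f x = - ((1 / m - 1) * f x)" by (simp add: algebra_simps)
        moreover have "0 \<le> 1 / m - 1" using \<open>0 < m\<close> \<open>0 \<le> 1 - m\<close> by simp
        ultimately show ?thesis by (simp add: abs_mult)
      qed
      then show "\<bar>f x - g x\<bar> =
          \<bar>f x\<bar> * indicator (space M - A) x + (1 / m - 1) * (\<bar>f x\<bar> * indicator A x)"
        using \<open>x \<in> space M\<close> by (auto simp: g_def indicator_def)
    qed simp
    also have "\<dots> = (1 - m) + (1 / m - 1) * m"
      using int_ind A by (simp add: compl m_def[symmetric])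
    also have "\<dots> = 2 * (1 - m)" using \<open>0 < m\<close> by (simp add: field_simps)
    finally show ?thesis using m \<open>0 < \<epsilon>\<close> by simp
  qed
  ultimately show ?thesis
    using kernel_operator_in_L1_operators g norm_g norm_Sg continuous_in_measure_kernel_operator
      \<open>0 < \<epsilon>\<close> by (intro exI[of _ ?S] exI[of _ g]) (auto simp: \<eta>_def)
qed

end
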